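(* Let $F$ be a field with a derivation $x\mapsto x'$ and field of constants $C$, and let $A$ be a finite-dimensional $C$-algebra whose automorphism scheme ${\rm Aut}_A$ is smooth. Let $B$ be a form of $A$ over $F$. Then there is a derivation of $B$ extending the derivation of $F$.
   Context: Algebras are associative with unit, not necessarily commutative. A derivation of a ring $R$ is an additive map $\delta:R\to R$ with $\delta(ab)=\delta(a)b+a\delta(b)$ for all $a,b\in R$; a constant is an element killed by the derivation. A derivation $\delta$ of an $F$-algebra $B$ extends the derivation of $F$ if $\delta(x\cdot 1_B)=x'\cdot 1_B$ for all $x\in F$. The automorphism scheme ${\rm Aut}_A$ is the algebraic group scheme over $C$ sending a commutative $C$-algebra $S$ to the group of all $S$-algebra automorphisms of $A\otimes_C S$. Let $\bar F$ be the separable closure of $F$. A form of $A$ over $F$ is an $F$-algebra $B$ such that $A\otimes_C\bar F\cong B\otimes_F\bar F$ as $\bar F$-algebras. *)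

theory Defs
  imports
    "HOL-Algebra.Algebra"
    "HOL-Algebra.Free_Abelian_Groups"
    "HOL-Algebra.Algebraic_Closure_Type"
begin

section \<open>Derivations\<close>

definition derivation :: "('a, 'm) ring_scheme \<Rightarrow> ('a \<Rightarrow> 'a) \<Rightarrow> bool" where
  "derivation R d \<longleftrightarrow>
     d \<in> carrier R \<rightarrow> carrier R \<and>
     (\<forall>a\<in>carrier R. \<forall>b\<in>carrier R. d (a \<oplus>\<^bsub>R\<^esub> b) = d a \<oplus>\<^bsub>R\<^esub> d b) \<and>
     (\<forall>a\<in>carrier R. \<forall>b\<in>carrier R. d (a \<otimes>\<^bsub>R\<^esub> b) = d a \<otimes>\<^bsub>R\<^esub> b \<oplus>\<^bsub>R\<^esub> a \<otimes>\<^bsub>R\<^esub> d b)"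

definition constants :: "('a, 'm) ring_scheme \<Rightarrow> ('a \<Rightarrow> 'a) \<Rightarrow> ('a, 'm) ring_scheme" where
  "constants R d = R\<lparr>carrier := {x \<in> carrier R. d x = \<zero>\<^bsub>R\<^esub>}\<rparr>"


section \<open>Associative unital algebras\<close>

text \<open>The library locale \<^locale>\<open>algebra\<close> demands a commutative multiplication; it is used below
  for commutative algebras, and the following locale for general ones.\<close>

locale assoc_algebra = module R A + ring A for R (structure) and A (structure) +
  assumes smult_mult_left:
      "\<lbrakk>c \<in> carrier R; x \<in> carrier A; y \<in> carrier A\<rbrakk>
        \<Longrightarrow> (c \<odot>\<^bsub>A\<^esub> x) \<otimes>\<^bsub>A\<^esub> y = c \<odot>\<^bsub>A\<^esub> (x \<otimes>\<^bsub>A\<^esub> y)"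
    and smult_mult_right:
      "\<lbrakk>c \<in> carrier R; x \<in> carrier A; y \<in> carrier A\<rbrakk>
        \<Longrightarrow> x \<otimes>\<^bsub>A\<^esub> (c \<odot>\<^bsub>A\<^esub> y) = c \<odot>\<^bsub>A\<^esub> (x \<otimes>\<^bsub>A\<^esub> y)"

definition finitely_spanned :: "('c, 'm) ring_scheme \<Rightarrow> ('c, 'a, 'n) module_scheme \<Rightarrow> bool" where
  "finitely_spanned R A \<longleftrightarrow>
     (\<exists>G. finite G \<and> G \<subseteq> carrier A \<and>
        (\<forall>a\<in>carrier A. \<exists>c \<in> G \<rightarrow> carrier R. a = (\<Oplus>\<^bsub>A\<^esub>x\<in>G. c x \<odot>\<^bsub>A\<^esub> x)))"

definition alg_hom ::
  "('c, 'm) ring_scheme \<Rightarrow> ('c, 'a, 'n) module_scheme \<Rightarrow> ('c, 'b, 'o) module_scheme \<Rightarrow> ('a \<Rightarrow> 'b) set"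
where
  "alg_hom R A B = {h \<in> ring_hom A B. \<forall>c\<in>carrier R. \<forall>x\<in>carrier A. h (c \<odot>\<^bsub>A\<^esub> x) = c \<odot>\<^bsub>B\<^esub> h x}"

definition alg_iso ::
  "('c, 'm) ring_scheme \<Rightarrow> ('c, 'a, 'n) module_scheme \<Rightarrow> ('c, 'b, 'o) module_scheme \<Rightarrow> ('a \<Rightarrow> 'b) set"
where
  "alg_iso R A B = {h \<in> alg_hom R A B. bij_betw h (carrier A) (carrier B)}"


section \<open>Tensor product of an algebra with a commutative algebra\<close>

text \<open>The tensor product is the free abelian group on the pairs \<open>(a, s)\<close> modulo the bilinearity
  relations. The free group carries the multiplication \<open>(a, s) (b, t) = (a b, s t)\<close>, for which
  the subgroup generated by the relations is already an ideal, so that the quotient ring by the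
  ideal they generate has the usual tensor product as additive group.\<close>

definition free_pair_ring ::
  "('a, 'm) ring_scheme \<Rightarrow> ('s, 'n) ring_scheme \<Rightarrow> ('a \<times> 's \<Rightarrow>\<^sub>0 int) ring"
where
  "free_pair_ring A S =
     \<lparr>carrier = carrier (free_Abelian_group (carrier A \<times> carrier S)),
      monoid.mult = (\<lambda>f g. frag_extend (\<lambda>(a, s). frag_extend (\<lambda>(b, t).
                frag_of (a \<otimes>\<^bsub>A\<^esub> b, s \<otimes>\<^bsub>S\<^esub> t)) g) f),
      monoid.one = frag_of (\<one>\<^bsub>A\<^esub>, \<one>\<^bsub>S\<^esub>),
      ring.zero = 0,
      ring.add = (+)\<rparr>"

definition tensor_relations ::
  "('c, 'l) ring_scheme \<Rightarrow> ('c, 'a, 'm) module_scheme \<Rightarrow> ('c, 's, 'n) module_scheme \<Rightarrow>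
   ('a \<times> 's \<Rightarrow>\<^sub>0 int) set"
where
  "tensor_relations R A S =
     {frag_of (a \<oplus>\<^bsub>A\<^esub> b, s) - frag_of (a, s) - frag_of (b, s) | a b s.
        a \<in> carrier A \<and> b \<in> carrier A \<and> s \<in> carrier S} \<union>
     {frag_of (a, s \<oplus>\<^bsub>S\<^esub> t) - frag_of (a, s) - frag_of (a, t) | a s t.
        a \<in> carrier A \<and> s \<in> carrier S \<and> t \<in> carrier S} \<union>
     {frag_of (c \<odot>\<^bsub>A\<^esub> a, s) - frag_of (a, c \<odot>\<^bsub>S\<^esub> s) | c a s.
        c \<in> carrier R \<and> a \<in> carrier A \<and> s \<in> carrier S}"

definition tensor_ideal ::
  "('c, 'l) ring_scheme \<Rightarrow> ('c, 'a, 'm) module_scheme \<Rightarrow> ('c, 's, 'n) module_scheme \<Rightarrow>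
   ('a \<times> 's \<Rightarrow>\<^sub>0 int) set"
where
  "tensor_ideal R A S = Idl\<^bsub>free_pair_ring A S\<^esub> (tensor_relations R A S)"

text \<open>\<open>tensor R A S\<close> is an algebra over \<open>S\<close>, with \<open>s\<close> acting as multiplication by \<open>1 \<otimes> s\<close>.\<close>

definition tensor ::
  "('c, 'l) ring_scheme \<Rightarrow> ('c, 'a, 'm) module_scheme \<Rightarrow> ('c, 's, 'n) module_scheme \<Rightarrow>
   ('s, ('a \<times> 's \<Rightarrow>\<^sub>0 int) set) module"
where
  "tensor R A S =
     (let P = free_pair_ring A S; J = tensor_ideal R A S; Q = P Quot J in
      \<lparr>carrier = carrier Q, monoid.mult = monoid.mult Q, monoid.one = monoid.one Q,
       ring.zero = ring.zero Q, ring.add = ring.add Q,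
       module.smult = (\<lambda>s U. (J +>\<^bsub>P\<^esub> frag_of (\<one>\<^bsub>A\<^esub>, s)) \<otimes>\<^bsub>Q\<^esub> U)\<rparr>)"

text \<open>The map \<open>id \<otimes> f\<close> from \<open>tensor R A S\<close> to \<open>tensor R A T\<close>; all representatives of a coset
  have the same image.\<close>

definition tensor_map ::
  "('c, 'l) ring_scheme \<Rightarrow> ('c, 'a, 'm) module_scheme \<Rightarrow> ('c, 't, 'n) module_scheme \<Rightarrow>
   ('s \<Rightarrow> 't) \<Rightarrow> ('a \<times> 's \<Rightarrow>\<^sub>0 int) set \<Rightarrow> ('a \<times> 't \<Rightarrow>\<^sub>0 int) set"
where
  "tensor_map R A T f U =
     the_elem ((\<lambda>x. tensor_ideal R A T +>\<^bsub>free_pair_ring A T\<^esub>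
                     frag_extend (\<lambda>(a, s). frag_of (a, f s)) x) ` U)"


section \<open>The automorphism scheme and its smoothness\<close>

definition aut_scheme ::
  "('c, 'l) ring_scheme \<Rightarrow> ('c, 'a, 'm) module_scheme \<Rightarrow> ('c, 's, 'n) module_scheme \<Rightarrow>
   (('a \<times> 's \<Rightarrow>\<^sub>0 int) set \<Rightarrow> ('a \<times> 's \<Rightarrow>\<^sub>0 int) set) monoid"
where
  "aut_scheme R A S =
     BijGroup (carrier (tensor R A S))
       \<lparr>carrier := Bij (carrier (tensor R A S)) \<inter> alg_iso S (tensor R A S) (tensor R A S)\<rparr>"

text \<open>Smoothness over a base ring (EGA IV, 17.1.1 and 17.3.1) means locally of finite presentation
  and formally smooth: points lift, not necessarily uniquely, along every surjection of commutative
  algebras with square-zero kernel. The first condition is automatic over a field when \<open>A\<close> is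
  finite-dimensional, \<open>Aut\<^sub>A\<close> then being a closed subscheme of a general linear group.

  HOL cannot quantify over algebras of all types at once. Up to isomorphism, every finitely
  generated commutative algebra over \<open>R\<close> has its carrier in the type \<open>'c list\<close>. These
  suffice over a field: if \<open>Aut\<^sub>A\<close> is represented by the algebra \<open>P/J\<close> with \<open>P\<close> a polynomial ring in finitely
  many variables, then lifting along \<open>P/J\<^sup>2 \<rightarrow> P/J\<close> already gives lifting along all square-zero
  surjections.\<close>

definition smooth_aut_scheme :: "('c, 'l) ring_scheme \<Rightarrow> ('c, 'a, 'm) module_scheme \<Rightarrow> bool" where
  "smooth_aut_scheme R A \<longleftrightarrow>
     (\<forall>(S :: ('c, 'c list) module) (T :: ('c, 'c list) module) f.
        algebra R S \<and> algebra R T \<and> f \<in> alg_hom R S T \<and> f ` carrier S = carrier T \<and>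
        (\<forall>x \<in> a_kernel S T f. \<forall>y \<in> a_kernel S T f. x \<otimes>\<^bsub>S\<^esub> y = \<zero>\<^bsub>S\<^esub>) \<longrightarrow>
        (\<forall>\<psi> \<in> carrier (aut_scheme R A T). \<exists>\<phi> \<in> carrier (aut_scheme R A S).
           \<forall>x \<in> carrier (tensor R A S).
             tensor_map R A T f (\<phi> x) = \<psi> (tensor_map R A T f x)))"


section \<open>Separable closure and forms\<close>

definition separable_poly :: "'a::field poly \<Rightarrow> bool" where
  "separable_poly p \<longleftrightarrow> coprime p (pderiv p)"

text \<open>The field extension is given by its embedding \<open>i\<close>. An irreducible polynomial with root \<open>a\<close>
  is, up to a unit, the minimal polynomial of \<open>a\<close>.\<close>

locale separable_closure =
  fixes i :: "'f::field \<Rightarrow> 'l::field"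
  assumes embedding: "i \<in> ring_hom (ring_of_type_algebra :: 'f ring) (ring_of_type_algebra :: 'l ring)"
    and separable: "\<exists>p. Factorial_Ring.irreducible p \<and> separable_poly p \<and> poly (map_poly i p) a = 0"
    and separably_closed: "\<lbrakk>separable_poly q; Polynomial.degree q > 0\<rbrakk> \<Longrightarrow> \<exists>a::'l. poly q a = 0"

definition extension_algebra :: "('f::field \<Rightarrow> 'l::field) \<Rightarrow> ('f, 'l) module" where
  "extension_algebra i =
     \<lparr>carrier = UNIV, monoid.mult = (*), monoid.one = 1, ring.zero = 0, ring.add = (+),
      module.smult = (\<lambda>c x. i c * x)\<rparr>"

definition is_form ::
  "('f, 'k) ring_scheme \<Rightarrow> ('f, 'a, 'm) module_scheme \<Rightarrow>
   ('f, 'h) ring_scheme \<Rightarrow> ('f, 'b, 'n) module_scheme \<Rightarrow> ('f, 'l, 'o) module_scheme \<Rightarrow> bool"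
where
  "is_form C A F B L \<longleftrightarrow>
     assoc_algebra F B \<and> alg_iso L (tensor C A L) (tensor F B L) \<noteq> {}"

end

(* Let L be the separable closure of F. Since L is separable algebraic over F, the derivation D
   extends to a derivation E of L, and E is C-linear, so id (x) E is a derivation of A (x)_C L.
   Transport it along the isomorphism to a derivation e of B (x)_F L that extends E. An F-linear
   retraction pi of F -> L makes id (x) pi a homomorphism of B-bimodules B (x)_F L -> B, whence
   b |-> (id (x) pi) (e (b (x) 1)) is a derivation of B, and it extends D. *)
theory Submission
  imports Defs
begin

section \<open>Extending a derivation to a separable algebraic extension\<close>

text \<open>Nothing forces \<open>e\<close> to map B (x) 1 into itself, since the isomorphism of the
  two tensor products exists only over L; so the values e(b (x) 1) have to be brought back to B. The
  retraction is in general neither multiplicative nor compatible with E. This does no harm: in e(ab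
  (x) 1) = e(a (x) 1)(b (x) 1) + (a (x) 1) e(b (x) 1) each summand has a factor from B (x) 1, and
  such a factor can be pulled out on either side. Two steps cost work. L may have infinite degree
  over F, so E comes from Zorn's lemma. Its value at a new element a is forced to be -q^E(a)/q'(a),
  where q^E has the coefficients of q differentiated and q is the minimal polynomial of a over the
  domain reached so far; separability is known for polynomials over F only and has to be passed on
  to q. Secondly, the tensor product is a quotient by a two-sided ideal, whereas the maps defined on
  it here come from maps that are merely additive; it has to be shown that they vanish on the whole
  ideal and not only on the generating relations.\<close>

text \<open>A pair \<open>(x, y)\<close> stands for the dual number \<open>x + y \<epsilon>\<close>, \<open>\<epsilon>\<^sup>2 = 0\<close>: derivations on a subring
  are the subrings of dual numbers that are single-valued as relations, which makes Zorn's lemma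
  applicable to plain sets.\<close>

definition dual_subring :: "('a::comm_ring_1 \<times> 'a) set \<Rightarrow> bool" where
  "dual_subring G \<longleftrightarrow> (1, 0) \<in> G \<and>
     (\<forall>x y x' y'. (x, y) \<in> G \<longrightarrow> (x', y') \<in> G \<longrightarrow>
        (x - x', y - y') \<in> G \<and> (x * x', x * y' + y * x') \<in> G)"

section \<open>Subrings of dual numbers, and adjoining one element to them\<close>

context
  fixes G :: "('a::comm_ring_1 \<times> 'a) set"
  assumes G: "dual_subring G"
begin

lemma dual_subring_one: "(1, 0) \<in> G"
  and dual_subring_diff: "(x, y) \<in> G \<Longrightarrow> (x', y') \<in> G \<Longrightarrow> (x - x', y - y') \<in> G"
  and dual_subring_mult: "(x, y) \<in> G \<Longrightarrow> (x', y') \<in> G \<Longrightarrow> (x * x', x * y' + y * x') \<in> G"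
  using G by (auto simp: dual_subring_def)

lemma dual_subring_zero: "(0, 0) \<in> G"
  using dual_subring_diff[OF dual_subring_one dual_subring_one] by simp

lemma dual_subring_add: "(x, y) \<in> G \<Longrightarrow> (x', y') \<in> G \<Longrightarrow> (x + x', y + y') \<in> G"
  using dual_subring_diff[OF _ dual_subring_diff[OF dual_subring_zero]] by fastforce

lemma dual_subring_sum:
  "(\<And>k. k \<in> I \<Longrightarrow> (f k, g k) \<in> G) \<Longrightarrow> (\<Sum>k\<in>I. f k, \<Sum>k\<in>I. g k) \<in> G"
  by (induction I rule: infinite_finite_induct)
    (auto simp: dual_subring_zero intro: dual_subring_add)

end

text \<open>The pair (f, g) stands for the polynomial f + g \<epsilon> over the dual numbers. If
  \<open>G\<close> is the graph of a derivation, then g is f with the derivation applied to its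
  coefficients.\<close>

definition dual_polys :: "('a::comm_ring_1 \<times> 'a) set \<Rightarrow> ('a poly \<times> 'a poly) set" where
  "dual_polys G = {(f, g). \<forall>n. (coeff f n, coeff g n) \<in> G}"

lemma dual_polys_const: "dual_subring G \<Longrightarrow> (x, y) \<in> G \<Longrightarrow> ([:x:], [:y:]) \<in> dual_polys G"
  by (auto simp: dual_polys_def coeff_pCons dual_subring_zero split: nat.split)

lemma dual_polys_monom: "dual_subring G \<Longrightarrow> (x, y) \<in> G \<Longrightarrow> (monom x n, monom y n) \<in> dual_polys G"
  by (auto simp: dual_polys_def dual_subring_zero)

text \<open>A coefficient of a product is a sum of products of dual numbers from \<open>G\<close>.
  The closure rules proved for \<open>G\<close> thereby become available for pairs of
  polynomials.\<close>

lemma dual_polys_dual_subring: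
  assumes G: "dual_subring G"
  shows "dual_subring (dual_polys G)"
  unfolding dual_subring_def
proof (intro conjI allI impI)
  show "(1, 0) \<in> dual_polys G"
    using dual_polys_const[OF G dual_subring_one[OF G]] by (simp add: one_pCons)
next
  fix f g f' g' assume *: "(f, g) \<in> dual_polys G" "(f', g') \<in> dual_polys G"
  show "(f - f', g - g') \<in> dual_polys G"
    using * by (auto simp: dual_polys_def intro: dual_subring_diff[OF G])
  show "(f * f', f * g' + g * f') \<in> dual_polys G"
    using * by (auto simp: dual_polys_def coeff_mult sum.distrib[symmetric]
        intro!: dual_subring_sum[OF G] dual_subring_mult[OF G])
qed

text \<open>The map is evaluation at the dual number a + u \<epsilon>: expanding f + g \<epsilon>
  there gives f(a) + (g(a) + f'(a) u) \<epsilon>. Being a ring homomorphism, it has a subring as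
  image, namely the one generated by \<open>G\<close> and (a, u).\<close>

lemma dual_adjoin:
  fixes G :: "('a::idom \<times> 'a) set"
  assumes G: "dual_subring G"
  shows "dual_subring ((\<lambda>(f, g). (poly f a, poly g a + poly (pderiv f) a * u)) ` dual_polys G)"
    (is "dual_subring (?e ` _)")
proof -
  note P = dual_polys_dual_subring[OF G]
  show ?thesis
    unfolding dual_subring_def
  proof (intro conjI allI impI)
    show "(1, 0) \<in> ?e ` dual_polys G"
      by (rule image_eqI[OF _ dual_subring_one[OF P]]) simp
  next
    fix x y x' y' assume "(x, y) \<in> ?e ` dual_polys G" "(x', y') \<in> ?e ` dual_polys G"
    then obtain f g f' g' where *: "(f, g) \<in> dual_polys G" "(f', g') \<in> dual_polys G"
      and eq: "(x, y) = ?e (f, g)" "(x', y') = ?e (f', g')" by (force elim!: imageE)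
    show "(x - x', y - y') \<in> ?e ` dual_polys G"
      using eq by (intro image_eqI[OF _ dual_subring_diff[OF P *]])
        (simp add: pderiv_diff algebra_simps)
    show "(x * x', x * y' + y * x') \<in> ?e ` dual_polys G"
      using eq by (intro image_eqI[OF _ dual_subring_mult[OF P *]])
        (simp add: pderiv_mult algebra_simps)
  qed
qed

text \<open>The instance \<open>s = 1\<close> says that the extension to the ring generated by \<open>a\<close> is well defined; the
  instance \<open>s = 0, u = 1\<close> says that if the minimal polynomial \<open>q\<close> of \<open>a\<close> has \<open>a\<close> as a multiple root,
  then so has every polynomial vanishing at \<open>a\<close>.\<close>

lemma dual_polys_functional_vanishes:
  fixes G :: "('a::field \<times> 'a) set"
  assumes G: "dual_subring G" and single: "\<And>y. (0, y) \<in> G \<Longrightarrow> y = 0"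
    and inv: "\<And>x. x \<in> fst ` G \<Longrightarrow> inverse x \<in> fst ` G"
    and q: "(q, q') \<in> dual_polys G" "q \<noteq> 0" "poly q a = 0"
    and q_min: "\<And>f g. (f, g) \<in> dual_polys G \<Longrightarrow> f \<noteq> 0 \<Longrightarrow> poly f a = 0 \<Longrightarrow> degree q \<le> degree f"
    and q_zero: "poly q' a * s + poly (pderiv q) a * u = 0"
  shows "(f, g) \<in> dual_polys G \<Longrightarrow> poly f a = 0 \<Longrightarrow> poly g a * s + poly (pderiv f) a * u = 0"
proof (induction "degree f" arbitrary: f g rule: less_induct)
  case less
  note P = dual_polys_dual_subring[OF G]
  \<comment> \<open>Single-valuedness passes from \<open>G\<close> to polynomials coefficientwise;
    it settles the case of first component 0, where no degree is left to lower.\<close>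
  have zero: "g = 0" if "(0, g) \<in> dual_polys G" for g
    using that single by (auto simp: dual_polys_def poly_eq_iff)
  show ?case
  proof (cases "f = 0")
    case True
    then have "g = 0" using zero less.prems(1) by blast
    then show ?thesis using True by simp
  next
    case False
    have le: "degree q \<le> degree f" using q_min less.prems False by blast
    have "lead_coeff q \<in> fst ` G" "lead_coeff f \<in> fst ` G"
      using q(1) less.prems(1) by (force simp: dual_polys_def)+
    then obtain y y' where "(inverse (lead_coeff q), y) \<in> G" "(lead_coeff f, y') \<in> G"
      using inv[of "lead_coeff q"] by force
    \<comment> \<open>Division by \<open>q\<close> needs the quotient of the leading coefficients
      together with some partner \<open>c'\<close> in \<open>G\<close>; which partner is
      irrelevant.\<close>
    from dual_subring_mult[OF G this] obtain c c' where
      c: "(c, c') \<in> G" "c * lead_coeff q = lead_coeff f"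
      using q(2) by fastforce
    define k where "k = degree f - degree q"
    define f1 where "f1 = f - monom c k * q"
    define g1 where "g1 = g - (monom c k * q' + monom c' k * q)"
    have c0: "c \<noteq> 0" using c(2) False by auto
    have 1: "(f1, g1) \<in> dual_polys G"
      unfolding f1_def g1_def
      by (rule dual_subring_diff[OF P less.prems(1)
            dual_subring_mult[OF P dual_polys_monom[OF G c(1)] q(1)]])
    have f1a: "poly f1 a = 0" using less.prems(2) q(3) by (simp add: f1_def)
    have "poly g1 a * s + poly (pderiv f1) a * u = 0"
    proof (cases "f1 = 0")
      case True
      then have "g1 = 0" using zero 1 by blast
      then show ?thesis using True by simp
    next
      case f1: False
      have d: "degree (monom c k * q) = degree f"
        using q(2) c0 le by (simp add: degree_mult_eq degree_monom_eq k_def)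
      have "coeff f1 (degree f) = 0"
        using d lead_coeff_mult[of "monom c k" q] c(2) c0
          by (simp only: f1_def coeff_diff degree_monom_eq[OF c0] lead_coeff_monom) simp
      moreover have "degree f1 \<le> degree f"
        unfolding f1_def by (rule degree_diff_le) (simp_all add: d)
      ultimately have "degree f1 < degree f"
        using f1 by (metis leading_coeff_0_iff order_le_less)
      then show ?thesis using less.hyps 1 f1a by blast
    qed
    \<comment> \<open>On a product of a pair (m, m') with (q, q') the functional is m(a) times its
      value at (q, q') plus a multiple of q(a), by the product rule, and q(a) = 0.\<close>
    moreover have "poly g a * s + poly (pderiv f) a * u
        = poly g1 a * s + poly (pderiv f1) a * u
          + poly (monom c k) a * (poly q' a * s + poly (pderiv q) a * u)"
      using q(3) by (simp add: f1_def g1_def pderiv_diff pderiv_mult algebra_simps)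
    ultimately show ?thesis using q_zero by simp
  qed
qed

section \<open>Field embeddings and roots of separable polynomials\<close>

locale field_embedding =
  fixes i :: "'f::field \<Rightarrow> 'l::field"
  assumes one: "i 1 = 1" and add: "i (x + y) = i x + i y" and mult: "i (x * y) = i x * i y"
begin

lemma zero: "i 0 = 0"
  using add[of 0 0] by (simp only: add_0_left add_cancel_right_right)

lemma minus: "i (- x) = - i x"
  using add[of x "- x"] zero by (simp add: eq_neg_iff_add_eq_0 add.commute)

lemma inverse: "i (inverse x) = inverse (i x)"
proof (cases "x = 0")
  case False
  then have "i x * i (inverse x) = 1" by (simp add: mult[symmetric] one)
  then show ?thesis by (simp add: inverse_unique)
qed (simp add: zero)

lemma eq_0_iff: "i x = 0 \<longleftrightarrow> x = 0"
  by (metis inverse inverse_zero mult mult_zero_left one right_inverse zero zero_neq_one)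

lemma of_nat: "i (of_nat n) = of_nat n"
  by (induction n) (simp_all add: zero one add)

lemma map_poly_add: "map_poly i (p + q) = map_poly i p + map_poly i q"
  by (rule poly_eqI) (simp add: coeff_map_poly zero add)

lemma poly_map_poly_mult: "poly (map_poly i (p * q)) x = poly (map_poly i p) x * poly (map_poly i q) x"
proof (induction p)
  case (pCons a p)
  have "map_poly i (smult a q) = smult (i a) (map_poly i q)"
    by (rule poly_eqI) (simp add: coeff_map_poly zero mult)
  then show ?case
    using pCons by (simp add: map_poly_add map_poly_pCons zero algebra_simps)
qed simp

lemma map_poly_pderiv: "map_poly i (pderiv p) = pderiv (map_poly i p)"
  by (rule poly_eqI) (simp add: coeff_map_poly coeff_pderiv zero mult of_nat add one)

lemma map_poly_eq_0: "map_poly i p = 0 \<longleftrightarrow> p = 0"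
  by (simp add: map_poly_eq_0_iff zero eq_0_iff poly_eq_iff coeff_map_poly)

text \<open>If the constant term c of p is nonzero, then p(x) = 0 reads x r(x) = -c and can be
  solved for the inverse; otherwise cancel x and repeat. Hence a ring between F and an algebraic
  extension is a field.\<close>

lemma inverse_eq_poly:
  "p \<noteq> 0 \<Longrightarrow> poly (map_poly i p) x = 0 \<Longrightarrow> x \<noteq> 0 \<Longrightarrow> \<exists>r. inverse x = poly (map_poly i r) x"
proof (induction p)
  case (pCons c p)
  show ?case
  proof (cases "c = 0")
    case True
    then show ?thesis using pCons by (simp add: map_poly_pCons zero)
  next
    case False
    have "i c + x * poly (map_poly i p) x = 0" using pCons.prems by (simp add: map_poly_pCons zero)
    then have "x * poly (map_poly i p) x = - i c" by (simp add: add_eq_0_iff2)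
    then have "inverse x = - inverse (i c) * poly (map_poly i p) x"
      using False pCons.prems(3) eq_0_iff by (simp add: field_simps)
    also have "\<dots> = poly (map_poly i ([:- inverse c:] * p)) x"
      by (simp only: poly_map_poly_mult) (simp add: map_poly_pCons zero minus inverse)
    finally show ?thesis by blast
  qed
qed simp

text \<open>\<open>separable_poly\<close> is coprimality over the small field, while the root lies
  in the large one. A common root of p and p' would make its minimal polynomial \<open>m\<close>
  over the small field a common divisor, hence a nonzero constant, which has no root.\<close>

lemma poly_pderiv_neq_0:
  assumes "separable_poly p" "poly (map_poly i p) a = 0"
  shows "poly (pderiv (map_poly i p)) a \<noteq> 0"
proof
  assume "poly (pderiv (map_poly i p)) a = 0"
  then have p': "poly (map_poly i (pderiv p)) a = 0" by (simp add: map_poly_pderiv)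
  let ?Q = "\<lambda>m. m \<noteq> 0 \<and> poly (map_poly i m) a = 0"
  have p0: "p \<noteq> 0" using assms(1) by (auto simp: separable_poly_def)
  define m where "m = arg_min degree ?Q"
  have m: "?Q m" and m_min: "\<And>r. ?Q r \<Longrightarrow> degree m \<le> degree r"
    using arg_min_nat_lemma[of ?Q p degree] p0 assms(2) unfolding m_def by auto
  have "m dvd r" if r: "poly (map_poly i r) a = 0" for r
  proof -
    have "poly (map_poly i (m * (r div m) + r mod m)) a = 0" using r by simp
    then have "poly (map_poly i (r mod m)) a = 0"
      using m by (simp only: map_poly_add poly_add poly_map_poly_mult) simp
    then have "r mod m = 0"
      using m_min[of "r mod m"] degree_mod_less[of m r] m by force
    then show ?thesis by auto
  qed
  then have "is_unit m" using assms p' by (auto simp: separable_poly_def coprime_def)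
  then obtain c where "m = [:c:]" "c \<noteq> 0"
    by (metis is_unit_pCons_iff is_unit_polyE dvd_field_iff)
  then show False using m by (simp add: map_poly_pCons zero eq_0_iff)
qed

text \<open>A maximal single-valued subring \<open>M\<close> of dual numbers above the graph of
  \<open>D\<close> has a field as domain. For each a, adjoining a + u \<epsilon> with the one
  possible u gives a single-valued subring again, which by maximality is \<open>M\<close>; so a was
  in the domain already.\<close>

lemma derivation_extends:
  assumes D_add: "\<And>x y. D (x + y) = D x + D y" and D_mult: "\<And>x y. D (x * y) = D x * y + x * D y"
    and sep: "\<And>a. \<exists>p. separable_poly p \<and> poly (map_poly i p) a = 0"
  obtains E where "\<And>x y. E (x + y) = E x + E y" "\<And>x y. E (x * y) = E x * y + x * E y"
    "\<And>x. E (i x) = i (D x)"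
proof -
  have D0: "D 0 = 0" using D_add[of 0 0] by (simp only: add_0_left add_cancel_right_right)
  have D1: "D 1 = 0" using D_mult[of 1 1] by (simp only: mult_1_left mult_1_right add_cancel_right_right)
  have Dm: "D (- x) = - D x" for x
    using D_add[of x "- x"] D0 by (simp add: eq_neg_iff_add_eq_0 add.commute)
  \<comment> \<open>The graphs of partial extensions of \<open>D\<close>. Closure under differences
    is the reason why single-valuedness need only be demanded at 0.\<close>
  define \<G> where "\<G> = {G. dual_subring G \<and> (\<forall>y. (0, y) \<in> G \<longrightarrow> y = 0) \<and> range (\<lambda>x. (i x, i (D x))) \<subseteq> G}"
  have base: "range (\<lambda>x. (i x, i (D x))) \<in> \<G>"
  proof -
    have "(i x - i x', i (D x) - i (D x')) = (i (x - x'), i (D (x - x')))" for x x'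
      using add[of x "- x'"] add[of "D x" "- D x'"] D_add[of x "- x'"] by (simp add: minus Dm)
    moreover have "(i x * i x', i x * i (D x') + i (D x) * i x') = (i (x * x'), i (D (x * x')))" for x x'
      by (simp add: mult add D_mult add.commute)
    moreover have "(1, 0) = (i 1, i (D 1))" by (simp add: one D1 zero)
    ultimately show ?thesis
      unfolding \<G>_def dual_subring_def
      using eq_0_iff D0 by (auto simp del: prod.inject)
  qed
  have "\<exists>M\<in>\<G>. \<forall>N\<in>\<G>. M \<subseteq> N \<longrightarrow> N = M"
  proof (rule subset_Zorn_nonempty)
    show "\<G> \<noteq> {}" using base by blast
    fix \<C> assume ne: "\<C> \<noteq> {}" and chain: "subset.chain \<G> \<C>"
    have sub: "\<C> \<subseteq> \<G>" and comparable: "\<And>G H. G \<in> \<C> \<Longrightarrow> H \<in> \<C> \<Longrightarrow> G \<subseteq> H \<or> H \<subseteq> G"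
      using chain by (auto simp: subset_chain_def)
    obtain G0 where "G0 \<in> \<C>" using ne by blast
    have ring: "dual_subring G" if "G \<in> \<C>" for G
      using that sub by (auto simp: \<G>_def)
    have "dual_subring (\<Union>\<C>)"
      unfolding dual_subring_def
    proof (intro conjI allI impI)
      show "(1, 0) \<in> \<Union>\<C>"
        using dual_subring_one[OF ring[OF \<open>G0 \<in> \<C>\<close>]] \<open>G0 \<in> \<C>\<close> by (rule UnionI[rotated])
      fix x y x' y' assume "(x, y) \<in> \<Union>\<C>" "(x', y') \<in> \<Union>\<C>"
      then obtain G where G: "G \<in> \<C>" "(x, y) \<in> G" "(x', y') \<in> G"
        using comparable by (elim UnionE) (meson subsetD)
      from dual_subring_diff[OF ring this(2,3)] dual_subring_mult[OF ring this(2,3)] G(1)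
      show "(x - x', y - y') \<in> \<Union>\<C>" "(x * x', x * y' + y * x') \<in> \<Union>\<C>"
        by (meson UnionI)+
    qed
    moreover have "y = 0" if "(0, y) \<in> \<Union>\<C>" for y
      using that sub by (auto simp: \<G>_def)
    moreover have "range (\<lambda>x. (i x, i (D x))) \<subseteq> \<Union>\<C>"
    proof -
      have "range (\<lambda>x. (i x, i (D x))) \<subseteq> G0" using sub \<open>G0 \<in> \<C>\<close> by (auto simp: \<G>_def)
      then show ?thesis using Union_upper[OF \<open>G0 \<in> \<C>\<close>] by (rule order_trans)
    qed
    ultimately show "\<Union>\<C> \<in> \<G>" by (simp add: \<G>_def)
  qed
  then obtain M where "M \<in> \<G>" and M_max: "\<And>N. N \<in> \<G> \<Longrightarrow> M \<subseteq> N \<Longrightarrow> N = M" by blast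
  then have M: "dual_subring M" and single: "\<And>y. (0, y) \<in> M \<Longrightarrow> y = 0"
    and D_M: "\<And>x. (i x, i (D x)) \<in> M"
    by (auto simp: \<G>_def)
  \<comment> \<open>With \<open>inverse_eq_poly\<close> this turns the domain of \<open>M\<close>
    into a field, as division by the minimal polynomial \<open>q\<close> below requires.\<close>
  have poly_M: "poly (map_poly i r) x \<in> fst ` M" if x: "x \<in> fst ` M" for x r
  proof (induction r)
    case 0
    show ?case using imageI[OF dual_subring_zero[OF M], of fst] by simp
  next
    case (pCons c r)
    obtain y where "(x, y) \<in> M" using x by auto
    moreover obtain z where "(poly (map_poly i r) x, z) \<in> M" using pCons.IH by auto
    ultimately have "(x * poly (map_poly i r) x, x * z + y * poly (map_poly i r) x) \<in> M"
      by (rule dual_subring_mult[OF M])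
    from imageI[OF dual_subring_add[OF M D_M this, of c], of fst]
    show ?case by (simp add: map_poly_pCons zero)
  qed
  have inv: "inverse x \<in> fst ` M" if "x \<in> fst ` M" for x
  proof (cases "x = 0")
    case True
    then show ?thesis using that by simp
  next
    case False
    obtain p where p: "separable_poly p" "poly (map_poly i p) x = 0" using sep by blast
    then have "p \<noteq> 0" by (auto simp: separable_poly_def)
    then obtain r where "inverse x = poly (map_poly i r) x"
      using inverse_eq_poly p(2) False by blast
    then show ?thesis using poly_M[OF that] by simp
  qed
  have total: "a \<in> fst ` M" for a
  proof -
    obtain p where p: "separable_poly p" "poly (map_poly i p) a = 0" using sep by blast
    have pM: "(map_poly i p, map_poly (\<lambda>x. i (D x)) p) \<in> dual_polys M"
      using D_M by (simp add: dual_polys_def coeff_map_poly zero D0)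
    \<comment> \<open>The least degree is taken over polynomials with coefficients in the domain of
      \<open>M\<close>, so \<open>q\<close> may properly divide the image of the separable
      polynomial \<open>p\<close>.\<close>
    let ?Q = "\<lambda>q. q \<noteq> 0 \<and> poly q a = 0 \<and> (\<exists>q'. (q, q') \<in> dual_polys M)"
    have "p \<noteq> 0" using p by (auto simp: separable_poly_def)
    then have ex: "?Q (map_poly i p)" using p pM by (auto simp: map_poly_eq_0)
    define q where "q = arg_min degree ?Q"
    have "?Q q" and q_min: "\<And>r. ?Q r \<Longrightarrow> degree q \<le> degree r"
      using arg_min_nat_lemma[of ?Q, OF ex, of degree] unfolding q_def by auto
    then obtain q' where q: "q \<noteq> 0" "poly q a = 0" "(q, q') \<in> dual_polys M" by blast
    have vanish: "poly g a * s + poly (pderiv f) a * u = 0"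
      if "poly q' a * s + poly (pderiv q) a * u = 0" "(f, g) \<in> dual_polys M" "poly f a = 0" for s u f g
      by (rule dual_polys_functional_vanishes[OF M single inv q(3,1,2) _ that])
        (use q_min in blast)+
    \<comment> \<open>If q'(a) were 0, then p'(a) would be 0 too, although a is a simple root of
      \<open>p\<close>; this is how separability over F reaches \<open>q\<close>.\<close>
    have dq: "poly (pderiv q) a \<noteq> 0"
      using vanish[of 0 1 "map_poly i p", OF _ pM p(2)] poly_pderiv_neq_0[OF p] by auto
    \<comment> \<open>the only possible value of the derivation at \<open>a\<close>, from differentiating \<open>q(a) = 0\<close>\<close>
    define u where "u = - poly q' a / poly (pderiv q) a"
    define M' where "M' = (\<lambda>(f, g). (poly f a, poly g a + poly (pderiv f) a * u)) ` dual_polys M"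
    have "M \<subseteq> M'"
    proof
      fix z assume "z \<in> M"
      then have "([:fst z:], [:snd z:]) \<in> dual_polys M" by (simp add: dual_polys_const[OF M])
      then show "z \<in> M'" unfolding M'_def by (rule rev_image_eqI) (simp add: pderiv_pCons)
    qed
    moreover have "M' \<in> \<G>"
      unfolding \<G>_def
    proof (intro CollectI conjI allI impI)
      show "dual_subring M'" unfolding M'_def by (rule dual_adjoin[OF M])
      show "range (\<lambda>x. (i x, i (D x))) \<subseteq> M'" using \<open>M \<subseteq> M'\<close> D_M by blast
      fix y assume "(0, y) \<in> M'"
      then obtain f g where "(f, g) \<in> dual_polys M" "poly f a = 0" "y = poly g a + poly (pderiv f) a * u"
        unfolding M'_def by auto
      then show "y = 0" using vanish[of 1 u f g] dq by (simp add: u_def)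
    qed
    ultimately have "M' = M" using M_max by blast
    moreover have "a \<in> fst ` M'"
    proof -
      \<comment> \<open>The indeterminate X has coefficients 0 and 1, both with partner 0;
        evaluation at a + u \<epsilon> sends it to (a, u).\<close>
      have "([:0, 1:], 0) \<in> dual_polys M"
        using dual_polys_monom[OF M dual_subring_one[OF M], of 1] by (simp add: monom_altdef)
      then have "(a, poly 0 a + poly (pderiv [:0, 1:]) a * u) \<in> M'"
        unfolding M'_def by (rule rev_image_eqI) simp
      from imageI[OF this, of fst] show ?thesis by simp
    qed
    ultimately show ?thesis by simp
  qed
  define E where "E a = (SOME y. (a, y) \<in> M)" for a
  have E_M: "(a, E a) \<in> M" for a
    unfolding E_def by (rule someI_ex[of "\<lambda>y. (a, y) \<in> M"]) (use total[of a] in auto)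
  have E_eq: "E a = y" if "(a, y) \<in> M" for a y
    using single[of "E a - y"] dual_subring_diff[OF M E_M[of a] that] by simp
  show thesis
  proof
    show "E (x + y) = E x + E y" for x y by (intro E_eq dual_subring_add[OF M] E_M)
    show "E (x * y) = E x * y + x * E y" for x y
      using E_eq[OF dual_subring_mult[OF M E_M[of x] E_M[of y]]] by (simp only: add.commute)
    show "E (i x) = i (D x)" for x by (rule E_eq) (rule D_M)
  qed
qed

end

section \<open>The tensor product\<close>

abbreviation frag_prod :: "('a, 'm) ring_scheme \<Rightarrow> ('s, 'n) ring_scheme \<Rightarrow>
    ('a \<times> 's \<Rightarrow>\<^sub>0 int) \<Rightarrow> ('a \<times> 's \<Rightarrow>\<^sub>0 int) \<Rightarrow> ('a \<times> 's \<Rightarrow>\<^sub>0 int)" where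
  "frag_prod A S f g \<equiv> monoid.mult (free_pair_ring A S) f g"

lemma free_pair_ring_simps [simp]:
  "carrier (free_pair_ring A S) = {x. Poly_Mapping.keys x \<subseteq> carrier A \<times> carrier S}"
  "\<one>\<^bsub>free_pair_ring A S\<^esub> = frag_of (\<one>\<^bsub>A\<^esub>, \<one>\<^bsub>S\<^esub>)"
  "\<zero>\<^bsub>free_pair_ring A S\<^esub> = 0"
  "x \<oplus>\<^bsub>free_pair_ring A S\<^esub> y = x + y"
  by (auto simp: free_pair_ring_def)

lemma frag_prod_of [simp]:
  "frag_prod A S (frag_of (a, s)) (frag_of (b, t)) = frag_of (a \<otimes>\<^bsub>A\<^esub> b, s \<otimes>\<^bsub>S\<^esub> t)"
  by (simp add: free_pair_ring_def)

lemmas frag_induct = free_Abelian_group_induct[consumes 1, case_names zero diff gen]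

text \<open>Additivity of the product in its right factor rests on this, since that factor sits
  inside the function which is extended over the left one.\<close>

lemma frag_extend_fun_diff:
  "frag_extend (\<lambda>x. f x - g x) c = frag_extend f c - frag_extend g c"
  by (induction c rule: frag_induction[OF subset_UNIV]) (simp_all add: frag_extend_diff)

lemma frag_prod_diff_left: "frag_prod A S (f - f') g = frag_prod A S f g - frag_prod A S f' g"
  by (simp add: free_pair_ring_def frag_extend_diff)

lemma frag_prod_diff_right: "frag_prod A S f (g - g') = frag_prod A S f g - frag_prod A S f g'"
  by (simp add: free_pair_ring_def frag_extend_diff case_prod_unfold frag_extend_fun_diff)

lemma frag_prod_zero [simp]: "frag_prod A S 0 g = 0" "frag_prod A S f 0 = 0"
  using frag_prod_diff_left[of A S 0 0 g] frag_prod_diff_right[of A S f 0 0] by simp_all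

lemma frag_prod_add_left: "frag_prod A S (f + f') g = frag_prod A S f g + frag_prod A S f' g"
  using frag_prod_diff_left[of A S f "- f'" g] frag_prod_diff_left[of A S 0 f' g] by simp

lemma frag_prod_add_right: "frag_prod A S f (g + g') = frag_prod A S f g + frag_prod A S f g'"
  using frag_prod_diff_right[of A S f g "- g'"] frag_prod_diff_right[of A S f 0 g'] by simp

lemmas frag_prod_linear = frag_prod_diff_left frag_prod_diff_right

text \<open>This is the integral monoid ring of the product of the two multiplicative monoids. All
  multiplicative axioms are additive in each argument, so they reduce to single pairs.\<close>

lemma ring_free_pair_ring:
  assumes "ring A" "ring S"
  shows "ring (free_pair_ring A S)"
proof -
  interpret A: ring A by fact
  interpret S: ring S by fact
  let ?X = "carrier A \<times> carrier S" and ?K = "Poly_Mapping.keys :: ('a \<times> 'c \<Rightarrow>\<^sub>0 int) \<Rightarrow> _"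
  have closed: "?K (frag_prod A S f g) \<subseteq> ?X" if "?K f \<subseteq> ?X" "?K g \<subseteq> ?X" for f g
    using that(1)
  proof (induction f rule: frag_induct)
    case (gen p)
    from that(2) gen show ?case
      by (induction g rule: frag_induct)
        (auto simp: frag_prod_linear dest!: subsetD[OF keys_diff])
  qed (auto simp: frag_prod_linear dest!: subsetD[OF keys_diff])
  have assoc: "frag_prod A S (frag_prod A S f g) h = frag_prod A S f (frag_prod A S g h)"
    if "?K f \<subseteq> ?X" "?K g \<subseteq> ?X" "?K h \<subseteq> ?X" for f g h
    using that(1)
  proof (induction f rule: frag_induct)
    case (gen p)
    from that(2) show ?case
    proof (induction g rule: frag_induct)
      case (gen q)
      from that(3) show ?case
      proof (induction h rule: frag_induct)
        case (gen r)
        then show ?case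
          using \<open>p \<in> _\<close> \<open>q \<in> _\<close> by (auto simp: A.m_assoc S.m_assoc)
      qed (simp_all add: frag_prod_linear)
    qed (simp_all add: frag_prod_linear)
  qed (simp_all add: frag_prod_linear)
  have one: "frag_prod A S (frag_of (\<one>\<^bsub>A\<^esub>, \<one>\<^bsub>S\<^esub>)) f = f" "frag_prod A S f (frag_of (\<one>\<^bsub>A\<^esub>, \<one>\<^bsub>S\<^esub>)) = f"
    if "?K f \<subseteq> ?X" for f
    using that by (induction f rule: frag_induct) (auto simp: frag_prod_linear)
  show ?thesis
  proof (rule ringI)
    show "abelian_group (free_pair_ring A S)"
    proof (rule abelian_groupI)
      fix x assume "x \<in> carrier (free_pair_ring A S)"
      then show "\<exists>y\<in>carrier (free_pair_ring A S). y \<oplus>\<^bsub>free_pair_ring A S\<^esub> x = \<zero>\<^bsub>free_pair_ring A S\<^esub>"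
        by (intro bexI[of _ "- x"]) auto
    qed (auto dest!: subsetD[OF keys_add])
    show "Group.monoid (free_pair_ring A S)"
      by (rule monoidI) (simp_all add: closed assoc one)
  qed (simp_all add: frag_prod_add_left frag_prod_add_right)
qed

definition tensor_pure ::
  "('c, 'l) ring_scheme \<Rightarrow> ('c, 'a, 'm) module_scheme \<Rightarrow> ('c, 's, 'n) module_scheme \<Rightarrow>
   'a \<Rightarrow> 's \<Rightarrow> ('a \<times> 's \<Rightarrow>\<^sub>0 int) set"
where
  "tensor_pure R A S a s = tensor_ideal R A S +>\<^bsub>free_pair_ring A S\<^esub> frag_of (a, s)"

lemma assoc_algebraD:
  assumes "assoc_algebra R A"
  shows "ring A"
    and "\<lbrakk>c \<in> carrier R; x \<in> carrier A\<rbrakk> \<Longrightarrow> c \<odot>\<^bsub>A\<^esub> x \<in> carrier A"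
    and "\<lbrakk>c \<in> carrier R; x \<in> carrier A; y \<in> carrier A\<rbrakk> \<Longrightarrow> (c \<odot>\<^bsub>A\<^esub> x) \<otimes>\<^bsub>A\<^esub> y = c \<odot>\<^bsub>A\<^esub> (x \<otimes>\<^bsub>A\<^esub> y)"
    and "\<lbrakk>c \<in> carrier R; x \<in> carrier A; y \<in> carrier A\<rbrakk> \<Longrightarrow> x \<otimes>\<^bsub>A\<^esub> (c \<odot>\<^bsub>A\<^esub> y) = c \<odot>\<^bsub>A\<^esub> (x \<otimes>\<^bsub>A\<^esub> y)"
proof -
  interpret assoc_algebra R A by fact
  show "ring A" by (rule assoc_algebra.axioms(2)[OF assms])
  show "\<lbrakk>c \<in> carrier R; x \<in> carrier A\<rbrakk> \<Longrightarrow> c \<odot>\<^bsub>A\<^esub> x \<in> carrier A" by (rule smult_closed)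
qed (fact assoc_algebra.smult_mult_left[OF assms] assoc_algebra.smult_mult_right[OF assms])+

section \<open>The tensor product as a ring, its pure tensors and its universal property\<close>

locale tensor_product =
  fixes R :: "('c, 'l) ring_scheme" and A :: "('c, 'a, 'm) module_scheme"
    and S :: "('c, 's, 'n) module_scheme"
  assumes A: "assoc_algebra R A" and S: "assoc_algebra R S"
begin

abbreviation "P \<equiv> free_pair_ring A S"
abbreviation "J \<equiv> tensor_ideal R A S"
abbreviation "T \<equiv> tensor R A S"
abbreviation "pure \<equiv> tensor_pure R A S"

sublocale A: ring A by (rule assoc_algebraD(1)[OF A])
sublocale S: ring S by (rule assoc_algebraD(1)[OF S])
sublocale P: ring P by (rule ring_free_pair_ring[OF A.ring_axioms S.ring_axioms])

lemmas smult = assoc_algebraD(2-4)[OF A] assoc_algebraD(2-4)[OF S]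

lemma relations_carrier: "tensor_relations R A S \<subseteq> carrier P"
  by (auto simp: tensor_relations_def smult dest!: subsetD[OF keys_diff])

sublocale J: ideal J P
  unfolding tensor_ideal_def by (rule P.genideal_ideal[OF relations_carrier])

lemma uminus_P: "x \<in> carrier P \<Longrightarrow> \<ominus>\<^bsub>P\<^esub> x = - x"
  by (rule P.minus_equality) auto

lemma minus_P: "y \<in> carrier P \<Longrightarrow> x \<ominus>\<^bsub>P\<^esub> y = x - y"
  unfolding a_minus_def by (subst uminus_P) auto

lemma tensor_simps:
  "carrier T = carrier (P Quot J)" "monoid.mult T = monoid.mult (P Quot J)"
  "\<one>\<^bsub>T\<^esub> = \<one>\<^bsub>P Quot J\<^esub>" "\<zero>\<^bsub>T\<^esub> = \<zero>\<^bsub>P Quot J\<^esub>" "ring.add T = ring.add (P Quot J)"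
  by (simp_all add: tensor_def Let_def)

text \<open>\<open>T\<close> and \<open>P Quot J\<close> share their ring operations but are records
  of different types, hence the axioms are carried over one by one.\<close>

sublocale T: ring T
proof -
  interpret Q: ring "P Quot J" by (rule J.quotient_is_ring)
  have inv: "\<exists>y\<in>carrier (P Quot J). y \<oplus>\<^bsub>P Quot J\<^esub> x = \<zero>\<^bsub>P Quot J\<^esub>" if "x \<in> carrier (P Quot J)" for x
    using Q.l_neg[OF that] Q.a_inv_closed[OF that] by blast
  have "abelian_group T"
    by (rule abelian_groupI, unfold tensor_simps)
      (use inv in \<open>auto simp: Q.a_ac intro: Q.a_closed\<close>)
  moreover have "Group.monoid T"
    by (rule monoidI, unfold tensor_simps) (auto simp: Q.m_assoc)
  ultimately show "ring T"
    by (rule ringI, unfold tensor_simps) (auto simp: Q.l_distr Q.r_distr)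
qed

lemma coset_T: "x \<in> carrier P \<Longrightarrow> J +>\<^bsub>P\<^esub> x \<in> carrier T"
  and coset_add: "x \<in> carrier P \<Longrightarrow> y \<in> carrier P \<Longrightarrow> (J +>\<^bsub>P\<^esub> x) \<oplus>\<^bsub>T\<^esub> (J +>\<^bsub>P\<^esub> y) = J +>\<^bsub>P\<^esub> (x + y)"
  and coset_mult: "x \<in> carrier P \<Longrightarrow> y \<in> carrier P \<Longrightarrow> (J +>\<^bsub>P\<^esub> x) \<otimes>\<^bsub>T\<^esub> (J +>\<^bsub>P\<^esub> y) = J +>\<^bsub>P\<^esub> (frag_prod A S x y)"
  using ring_hom_closed[OF J.rcos_ring_hom] ring_hom_add[OF J.rcos_ring_hom]
    ring_hom_mult[OF J.rcos_ring_hom] unfolding tensor_simps by simp_all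

lemma coset_zero: "J +>\<^bsub>P\<^esub> 0 = \<zero>\<^bsub>T\<^esub>"
  using P.a_coset_add_zero[OF J.a_subset] P.a_rcos_zero[OF J.ideal_axioms J.zero_closed]
  by (simp add: tensor_simps FactRing_def)

lemma coset_cases:
  assumes "U \<in> carrier T"
  obtains x where "x \<in> carrier P" "U = J +>\<^bsub>P\<^esub> x"
  using assms unfolding tensor_simps FactRing_simps by auto

lemma coset_eqI:
  assumes "x - y \<in> J" "x \<in> carrier P" "y \<in> carrier P"
  shows "J +>\<^bsub>P\<^esub> x = J +>\<^bsub>P\<^esub> y"
  using P.quotient_eq_iff_same_a_r_cos[OF J.ideal_axioms assms(2,3)] assms(1) minus_P[OF assms(3)]
  by simp

lemma relations_J: "tensor_relations R A S \<subseteq> J"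
  unfolding tensor_ideal_def by (rule P.genideal_self[OF relations_carrier])

lemma pure_closed: "a \<in> carrier A \<Longrightarrow> s \<in> carrier S \<Longrightarrow> pure a s \<in> carrier T"
  unfolding tensor_pure_def by (rule coset_T) simp

lemma pure_mult:
  "a \<in> carrier A \<Longrightarrow> s \<in> carrier S \<Longrightarrow> b \<in> carrier A \<Longrightarrow> t \<in> carrier S \<Longrightarrow>
    pure a s \<otimes>\<^bsub>T\<^esub> pure b t = pure (a \<otimes>\<^bsub>A\<^esub> b) (s \<otimes>\<^bsub>S\<^esub> t)"
  unfolding tensor_pure_def by (subst coset_mult) simp_all

lemma pure_add_left:
  assumes "a \<in> carrier A" "b \<in> carrier A" "s \<in> carrier S"
  shows "pure (a \<oplus>\<^bsub>A\<^esub> b) s = pure a s \<oplus>\<^bsub>T\<^esub> pure b s"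
proof -
  have "frag_of (a \<oplus>\<^bsub>A\<^esub> b, s) - (frag_of (a, s) + frag_of (b, s)) \<in> J"
    unfolding diff_diff_eq[symmetric]
    by (rule subsetD[OF relations_J]) (use assms in \<open>auto simp: tensor_relations_def\<close>)
  from coset_eqI[OF this] show ?thesis
    using assms by (simp add: tensor_pure_def coset_add keys_add[THEN subset_trans])
qed

lemma pure_zero_left: "s \<in> carrier S \<Longrightarrow> pure \<zero>\<^bsub>A\<^esub> s = \<zero>\<^bsub>T\<^esub>"
  using pure_add_left[of "\<zero>\<^bsub>A\<^esub>" "\<zero>\<^bsub>A\<^esub>" s] pure_closed[of "\<zero>\<^bsub>A\<^esub>" s] T.add.l_cancel_one by force

lemma pure_add_right:
  assumes "a \<in> carrier A" "s \<in> carrier S" "t \<in> carrier S"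
  shows "pure a (s \<oplus>\<^bsub>S\<^esub> t) = pure a s \<oplus>\<^bsub>T\<^esub> pure a t"
proof -
  have "frag_of (a, s \<oplus>\<^bsub>S\<^esub> t) - (frag_of (a, s) + frag_of (a, t)) \<in> J"
    unfolding diff_diff_eq[symmetric]
    by (rule subsetD[OF relations_J]) (use assms in \<open>auto simp: tensor_relations_def\<close>)
  from coset_eqI[OF this] show ?thesis
    using assms by (simp add: tensor_pure_def coset_add keys_add[THEN subset_trans])
qed

lemma pure_balanced:
  assumes "c \<in> carrier R" "a \<in> carrier A" "s \<in> carrier S"
  shows "pure (c \<odot>\<^bsub>A\<^esub> a) s = pure a (c \<odot>\<^bsub>S\<^esub> s)"
proof -
  have "frag_of (c \<odot>\<^bsub>A\<^esub> a, s) - frag_of (a, c \<odot>\<^bsub>S\<^esub> s) \<in> J"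
    by (rule subsetD[OF relations_J]) (use assms in \<open>auto simp: tensor_relations_def\<close>)
  from coset_eqI[OF this] show ?thesis
    using assms by (simp add: tensor_pure_def smult)
qed

lemma smult_T: "s \<odot>\<^bsub>T\<^esub> U = pure \<one>\<^bsub>A\<^esub> s \<otimes>\<^bsub>T\<^esub> U"
  by (simp add: tensor_def Let_def tensor_pure_def)

text \<open>Negatives need no case of their own: -(a (x) s) = (-a) (x) s is again a pure
  tensor.\<close>

lemma tensor_induct [consumes 1, case_names pure add]:
  assumes U: "U \<in> carrier T"
    and pure: "\<And>a s. a \<in> carrier A \<Longrightarrow> s \<in> carrier S \<Longrightarrow> Q (pure a s)"
    and add: "\<And>U V. U \<in> carrier T \<Longrightarrow> V \<in> carrier T \<Longrightarrow> Q U \<Longrightarrow> Q V \<Longrightarrow> Q (U \<oplus>\<^bsub>T\<^esub> V)"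
  shows "Q U"
proof -
  obtain x where x: "x \<in> carrier P" "U = J +>\<^bsub>P\<^esub> x" by (rule coset_cases[OF U])
  \<comment> \<open>Induction on the free group proceeds by differences, whereas \<open>Q\<close> is
    only closed under sums; carrying the property for x and -x together bridges the gap.\<close>
  let ?Q' = "\<lambda>x. Q (J +>\<^bsub>P\<^esub> x) \<and> Q (J +>\<^bsub>P\<^esub> (- x))"
  have neg: "J +>\<^bsub>P\<^esub> (- frag_of (a, s)) = pure (\<ominus>\<^bsub>A\<^esub> a) s" if "a \<in> carrier A" "s \<in> carrier S" for a s
  proof -
    have c: "pure a s \<in> carrier T" "pure (\<ominus>\<^bsub>A\<^esub> a) s \<in> carrier T"
      "J +>\<^bsub>P\<^esub> (- frag_of (a, s)) \<in> carrier T"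
      using that by (auto intro!: pure_closed coset_T)
    have "pure (\<ominus>\<^bsub>A\<^esub> a) s \<oplus>\<^bsub>T\<^esub> pure a s = \<zero>\<^bsub>T\<^esub>"
      using that by (simp add: pure_add_left[symmetric] A.l_neg pure_zero_left)
    then have "\<ominus>\<^bsub>T\<^esub> pure a s = pure (\<ominus>\<^bsub>A\<^esub> a) s" by (rule T.minus_equality) fact+
    moreover have "(J +>\<^bsub>P\<^esub> (- frag_of (a, s))) \<oplus>\<^bsub>T\<^esub> pure a s = \<zero>\<^bsub>T\<^esub>"
      unfolding tensor_pure_def using that by (subst coset_add) (simp_all add: coset_zero)
    then have "\<ominus>\<^bsub>T\<^esub> pure a s = J +>\<^bsub>P\<^esub> (- frag_of (a, s))" by (rule T.minus_equality) fact+
    ultimately show ?thesis by simp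
  qed
  have "?Q' x" if "Poly_Mapping.keys x \<subseteq> carrier A \<times> carrier S"
    using that
  proof (induction x rule: frag_induct)
    case zero
    show ?case
      using pure[of "\<zero>\<^bsub>A\<^esub>" "\<zero>\<^bsub>S\<^esub>"] by (simp add: pure_zero_left coset_zero)
  next
    case (diff x y)
    then have "Q ((J +>\<^bsub>P\<^esub> x) \<oplus>\<^bsub>T\<^esub> (J +>\<^bsub>P\<^esub> (- y)))" "Q ((J +>\<^bsub>P\<^esub> (- x)) \<oplus>\<^bsub>T\<^esub> (J +>\<^bsub>P\<^esub> y))"
      by (intro add coset_T; simp)+
    then show ?case
      using diff.hyps by (simp add: coset_add)
  next
    case (gen p)
    then obtain a s where p: "p = (a, s)" "a \<in> carrier A" "s \<in> carrier S" by blast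
    have "Q (pure a s)" "Q (pure (\<ominus>\<^bsub>A\<^esub> a) s)" by (intro pure A.a_inv_closed p)+
    then show ?case
      unfolding p(1) neg[OF p(2,3)] tensor_pure_def by blast
  qed
  then show ?thesis using x by simp
qed

text \<open>The target is a mere abelian group. The balanced map extends additively to the free
  group, and it kills the ideal because the set of relations is stable under multiplication by pairs
  from both sides.\<close>

lemma tensor_lift:
  fixes M :: "('x, 'y) ring_scheme"
  assumes M: "abelian_group M"
    and closed: "\<And>a s. a \<in> carrier A \<Longrightarrow> s \<in> carrier S \<Longrightarrow> \<phi> a s \<in> carrier M"
    and add_left: "\<And>a b s. a \<in> carrier A \<Longrightarrow> b \<in> carrier A \<Longrightarrow> s \<in> carrier S \<Longrightarrow>
      \<phi> (a \<oplus>\<^bsub>A\<^esub> b) s = \<phi> a s \<oplus>\<^bsub>M\<^esub> \<phi> b s"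
    and add_right: "\<And>a s t. a \<in> carrier A \<Longrightarrow> s \<in> carrier S \<Longrightarrow> t \<in> carrier S \<Longrightarrow>
      \<phi> a (s \<oplus>\<^bsub>S\<^esub> t) = \<phi> a s \<oplus>\<^bsub>M\<^esub> \<phi> a t"
    and balanced: "\<And>c a s. c \<in> carrier R \<Longrightarrow> a \<in> carrier A \<Longrightarrow> s \<in> carrier S \<Longrightarrow>
      \<phi> (c \<odot>\<^bsub>A\<^esub> a) s = \<phi> a (c \<odot>\<^bsub>S\<^esub> s)"
  obtains \<Phi> where "\<And>U. U \<in> carrier T \<Longrightarrow> \<Phi> U \<in> carrier M"
    "\<And>U V. U \<in> carrier T \<Longrightarrow> V \<in> carrier T \<Longrightarrow> \<Phi> (U \<oplus>\<^bsub>T\<^esub> V) = \<Phi> U \<oplus>\<^bsub>M\<^esub> \<Phi> V"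
    "\<And>a s. a \<in> carrier A \<Longrightarrow> s \<in> carrier S \<Longrightarrow> \<Phi> (pure a s) = \<phi> a s"
proof -
  interpret M: abelian_group M by fact
  have "(\<lambda>(a, s). \<phi> a s) ` (carrier A \<times> carrier S) \<subseteq> carrier (add_monoid M)"
    using closed by auto
  from comm_group.free_Abelian_group_universal[OF M.a_comm_group this]
  obtain h where h: "h \<in> hom (free_Abelian_group (carrier A \<times> carrier S)) (add_monoid M)"
    and "\<And>x. x \<in> carrier A \<times> carrier S \<Longrightarrow> h (frag_of x) = (case x of (a, s) \<Rightarrow> \<phi> a s)" by blast
  then have h_of: "h (frag_of (a, s)) = \<phi> a s" if "a \<in> carrier A" "s \<in> carrier S" for a s
    using that by auto
  have h_closed: "h x \<in> carrier M" if "x \<in> carrier P" for x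
    using hom_in_carrier[OF h, of x] that by simp
  have h_add: "h (x + y) = h x \<oplus>\<^bsub>M\<^esub> h y" if "x \<in> carrier P" "y \<in> carrier P" for x y
    using hom_mult[OF h, of x y] that by simp
  have P_diff: "x - y \<in> carrier P" if "x \<in> carrier P" "y \<in> carrier P" for x y
    using P.minus_closed[OF that] minus_P[OF that(2)] by simp
  have h_diff: "h (x - y) = h x \<ominus>\<^bsub>M\<^esub> h y" if "x \<in> carrier P" "y \<in> carrier P" for x y
  proof -
    have "h x = h (x - y) \<oplus>\<^bsub>M\<^esub> h y" using h_add[OF P_diff[OF that] that(2)] by simp
    then show ?thesis
      using h_closed[OF P_diff[OF that]] h_closed[OF that(2)]
      by (simp add: a_minus_def M.a_assoc M.r_neg)
  qed
  have neg_0: "\<ominus>\<^bsub>M\<^esub> \<zero>\<^bsub>M\<^esub> = \<zero>\<^bsub>M\<^esub>" by (rule M.minus_equality) auto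
  have h_0: "h 0 = \<zero>\<^bsub>M\<^esub>" using h_diff[of 0 0] h_closed[of 0] by (simp add: M.r_neg a_minus_def)
  have cancel: "u \<oplus>\<^bsub>M\<^esub> (v \<oplus>\<^bsub>M\<^esub> (\<ominus>\<^bsub>M\<^esub> u \<oplus>\<^bsub>M\<^esub> \<ominus>\<^bsub>M\<^esub> v)) = \<zero>\<^bsub>M\<^esub>"
    if "u \<in> carrier M" "v \<in> carrier M" for u v
    using M.r_neg[of "u \<oplus>\<^bsub>M\<^esub> v"] that by (simp add: M.minus_add M.a_assoc)
  have rel_0: "h x = \<zero>\<^bsub>M\<^esub>" if "x \<in> tensor_relations R A S" for x
    using that unfolding tensor_relations_def
    by (auto simp: h_diff h_of P_diff smult closed add_left add_right balanced keys_diff[THEN subset_trans]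
        M.minus_eq M.r_neg M.a_assoc cancel)
  \<comment> \<open>Multiplying by (b, t) and (d, u) replaces a by b a d and s by t s u in a
    relation and keeps its kind, by distributivity or by the compatibility of scalars with
    products.\<close>
  have rel_mult: "frag_prod A S (frag_prod A S (frag_of p) x) (frag_of q) \<in> tensor_relations R A S"
    if x: "x \<in> tensor_relations R A S" and p: "p \<in> carrier A \<times> carrier S" and q: "q \<in> carrier A \<times> carrier S" for x p q
  proof -
    obtain b t d u where pq: "p = (b, t)" "q = (d, u)"
      and c: "b \<in> carrier A" "t \<in> carrier S" "d \<in> carrier A" "u \<in> carrier S"
      using p q by auto
    from x consider
      (1) a a' s where "x = frag_of (a \<oplus>\<^bsub>A\<^esub> a', s) - frag_of (a, s) - frag_of (a', s)"
        "a \<in> carrier A" "a' \<in> carrier A" "s \<in> carrier S"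
    | (2) a s s' where "x = frag_of (a, s \<oplus>\<^bsub>S\<^esub> s') - frag_of (a, s) - frag_of (a, s')"
        "a \<in> carrier A" "s \<in> carrier S" "s' \<in> carrier S"
    | (3) r a s where "x = frag_of (r \<odot>\<^bsub>A\<^esub> a, s) - frag_of (a, r \<odot>\<^bsub>S\<^esub> s)"
        "r \<in> carrier R" "a \<in> carrier A" "s \<in> carrier S"
      unfolding tensor_relations_def by blast
    then show ?thesis
    proof cases
      case 1
      then show ?thesis unfolding tensor_relations_def using c
        by (intro UnI1 CollectI exI[of _ "b \<otimes>\<^bsub>A\<^esub> a \<otimes>\<^bsub>A\<^esub> d"] exI[of _ "b \<otimes>\<^bsub>A\<^esub> a' \<otimes>\<^bsub>A\<^esub> d"]
            exI[of _ "t \<otimes>\<^bsub>S\<^esub> s \<otimes>\<^bsub>S\<^esub> u"])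
          (simp add: pq frag_prod_linear A.r_distr A.l_distr)
    next
      case 2
      then show ?thesis unfolding tensor_relations_def using c
        by (intro UnI1 UnI2 CollectI exI[of _ "b \<otimes>\<^bsub>A\<^esub> a \<otimes>\<^bsub>A\<^esub> d"] exI[of _ "t \<otimes>\<^bsub>S\<^esub> s \<otimes>\<^bsub>S\<^esub> u"]
            exI[of _ "t \<otimes>\<^bsub>S\<^esub> s' \<otimes>\<^bsub>S\<^esub> u"])
          (simp add: pq frag_prod_linear S.r_distr S.l_distr)
    next
      case 3
      then show ?thesis unfolding tensor_relations_def using c
        by (intro UnI2 CollectI exI[of _ r] exI[of _ "b \<otimes>\<^bsub>A\<^esub> a \<otimes>\<^bsub>A\<^esub> d"] exI[of _ "t \<otimes>\<^bsub>S\<^esub> s \<otimes>\<^bsub>S\<^esub> u"])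
          (simp add: pq frag_prod_linear smult)
    qed
  qed
  \<comment> \<open>\<open>{x. h x = 0}\<close> itself need not be an ideal, as \<open>h\<close> is only additive.\<close>
  define I where "I = {x \<in> carrier P. \<forall>y\<in>carrier P. \<forall>z\<in>carrier P. h (frag_prod A S (frag_prod A S y x) z) = \<zero>\<^bsub>M\<^esub>}"
  have cl: "frag_prod A S x y \<in> carrier P" if "x \<in> carrier P" "y \<in> carrier P" for x y
    using that by (rule P.m_closed)
  have "ideal I P"
  proof (rule idealI[OF P.ring_axioms])
    show "subgroup I (add_monoid P)"
    proof (rule group.subgroupI[OF P.a_group])
      show "I \<subseteq> carrier (add_monoid P)" by (auto simp: I_def)
      show "I \<noteq> {}" using h_0 by (auto simp: I_def intro!: exI[of _ 0])
    next
      fix x assume "x \<in> I"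
      then have x: "x \<in> carrier P" and hx: "\<And>y z. y \<in> carrier P \<Longrightarrow> z \<in> carrier P \<Longrightarrow> h (frag_prod A S (frag_prod A S y x) z) = \<zero>\<^bsub>M\<^esub>"
        unfolding I_def by blast+
      have "h (frag_prod A S (frag_prod A S y (- x)) z) = \<zero>\<^bsub>M\<^esub>" if "y \<in> carrier P" "z \<in> carrier P" for y z
      proof -
        have "0 \<in> carrier P" by simp
        moreover have "frag_prod A S (frag_prod A S y (- x)) z = 0 - frag_prod A S (frag_prod A S y x) z"
          using frag_prod_diff_right[of A S y 0 x] frag_prod_diff_left[of A S 0 "frag_prod A S y x" z] by simp
        ultimately show ?thesis
          using h_diff[of 0 "frag_prod A S (frag_prod A S y x) z"] hx that x cl h_0
          by (simp add: M.minus_eq neg_0 del: free_pair_ring_simps(1))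
      qed
      then show "inv\<^bsub>add_monoid P\<^esub> x \<in> I"
        using x uminus_P[OF x] unfolding a_inv_def[symmetric] by (simp add: I_def)
    next
      fix x y assume "x \<in> I" "y \<in> I"
      then show "x \<otimes>\<^bsub>add_monoid P\<^esub> y \<in> I"
        using P.a_closed[of x y]
        by (simp add: I_def frag_prod_add_left frag_prod_add_right h_add cl del: free_pair_ring_simps(1))
    qed
  next
    fix a x assume a: "a \<in> I" and x: "x \<in> carrier P"
    then have aP: "a \<in> carrier P" by (simp add: I_def)
    show "x \<otimes>\<^bsub>P\<^esub> a \<in> I" "a \<otimes>\<^bsub>P\<^esub> x \<in> I"
      using a x cl aP
      by (auto simp: I_def P.m_assoc[symmetric] simp del: free_pair_ring_simps(1))
        (metis P.m_assoc cl)
  qed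
  \<comment> \<open>Additivity in both outer factors reduces them to single pairs, where
    \<open>rel_mult\<close> applies.\<close>
  moreover have "tensor_relations R A S \<subseteq> I"
  proof
    fix x assume x: "x \<in> tensor_relations R A S"
    then have xP: "x \<in> carrier P" using relations_carrier by blast
    have "h (frag_prod A S (frag_prod A S y x) z) = \<zero>\<^bsub>M\<^esub>" if y: "y \<in> carrier P" and z: "z \<in> carrier P" for y z
    proof -
      from y have "Poly_Mapping.keys y \<subseteq> carrier A \<times> carrier S" by simp
      then show ?thesis
      proof (induction y rule: frag_induct)
        case (diff y y')
        then show ?case using z xP cl
          by (simp add: frag_prod_linear h_diff M.r_neg M.minus_eq)
      next
        case (gen p)
        from z have "Poly_Mapping.keys z \<subseteq> carrier A \<times> carrier S" by simp
        then show ?case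
        proof (induction z rule: frag_induct)
          case (diff z z')
          then show ?case using xP gen cl
            by (simp add: frag_prod_linear h_diff M.r_neg M.minus_eq)
        next
          case (gen q)
          then show ?case by (intro rel_0 rel_mult x \<open>p \<in> _\<close>)
        qed (simp add: h_0)
      qed (simp add: h_0)
    qed
    then show "x \<in> I" using xP by (simp add: I_def)
  qed
  ultimately have "J \<subseteq> I" unfolding tensor_ideal_def by (rule P.genideal_minimal)
  have h_J: "h x = \<zero>\<^bsub>M\<^esub>" if x: "x \<in> J" for x
  proof -
    have "x \<in> carrier P" "h (frag_prod A S (frag_prod A S \<one>\<^bsub>P\<^esub> x) \<one>\<^bsub>P\<^esub>) = \<zero>\<^bsub>M\<^esub>"
      using x \<open>J \<subseteq> I\<close> P.one_closed unfolding I_def by blast+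
    then show ?thesis by (metis P.l_one P.r_one)
  qed
  \<comment> \<open>The choice of a representative is harmless, as two of them differ by an element
    of \<open>J\<close>, on which \<open>h\<close> vanishes.\<close>
  define \<Phi> where "\<Phi> U = h (SOME x. x \<in> U)" for U
  have \<Phi>: "\<Phi> (J +>\<^bsub>P\<^esub> x) = h x" if x: "x \<in> carrier P" for x
  proof -
    have "(SOME y. y \<in> J +>\<^bsub>P\<^esub> x) \<in> J +>\<^bsub>P\<^esub> x"
      using J.a_rcos_self[OF x] by (rule someI)
    then obtain j where "j \<in> J" "(SOME y. y \<in> J +>\<^bsub>P\<^esub> x) = j + x"
      by (auto simp: a_r_coset_def r_coset_def)
    then show ?thesis
      using h_add[OF J.a_Hcarr x] h_J h_closed[OF x] by (simp add: \<Phi>_def)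
  qed
  show thesis
  proof
    fix U V assume "U \<in> carrier T" "V \<in> carrier T"
    then obtain x y where "x \<in> carrier P" "U = J +>\<^bsub>P\<^esub> x" "y \<in> carrier P" "V = J +>\<^bsub>P\<^esub> y"
      by (metis coset_cases)
    then show "\<Phi> (U \<oplus>\<^bsub>T\<^esub> V) = \<Phi> U \<oplus>\<^bsub>M\<^esub> \<Phi> V"
      using P.a_closed[of x y] by (simp add: coset_add \<Phi> h_add)
  next
    fix U assume "U \<in> carrier T"
    then show "\<Phi> U \<in> carrier M" by (elim coset_cases) (simp only: \<Phi> h_closed)
  next
    fix a s assume "a \<in> carrier A" "s \<in> carrier S"
    then show "\<Phi> (pure a s) = \<phi> a s" by (simp add: tensor_pure_def \<Phi> h_of)
  qed
qed

end

section \<open>Derivations and projections induced from the second factor\<close>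

context tensor_product
begin

text \<open>Linearity of \<open>E\<close> over \<open>R\<close> makes the assignment of a (x) E s to
  (a, s) balanced. Both sides of the product rule are additive in each argument, so pure tensors
  suffice, and there it is the product rule of \<open>E\<close>.\<close>

lemma derivation_tensor:
  assumes E: "derivation S E"
    and linear: "\<And>c s. c \<in> carrier R \<Longrightarrow> s \<in> carrier S \<Longrightarrow> E (c \<odot>\<^bsub>S\<^esub> s) = c \<odot>\<^bsub>S\<^esub> E s"
  shows "\<exists>d. derivation T d \<and> (\<forall>a\<in>carrier A. \<forall>s\<in>carrier S. d (pure a s) = pure a (E s))"
proof -
  have E_closed: "E s \<in> carrier S" if "s \<in> carrier S" for s
    using E that by (auto simp: derivation_def)
  have E_add: "E (s \<oplus>\<^bsub>S\<^esub> t) = E s \<oplus>\<^bsub>S\<^esub> E t"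
    and E_mult: "E (s \<otimes>\<^bsub>S\<^esub> t) = E s \<otimes>\<^bsub>S\<^esub> t \<oplus>\<^bsub>S\<^esub> s \<otimes>\<^bsub>S\<^esub> E t"
    if "s \<in> carrier S" "t \<in> carrier S" for s t
    using E that by (auto simp: derivation_def)
  obtain d where d_closed: "\<And>U. U \<in> carrier T \<Longrightarrow> d U \<in> carrier T"
    and d_add: "\<And>U V. U \<in> carrier T \<Longrightarrow> V \<in> carrier T \<Longrightarrow> d (U \<oplus>\<^bsub>T\<^esub> V) = d U \<oplus>\<^bsub>T\<^esub> d V"
    and d_pure: "\<And>a s. a \<in> carrier A \<Longrightarrow> s \<in> carrier S \<Longrightarrow> d (pure a s) = pure a (E s)"
    by (rule tensor_lift[of T "\<lambda>a s. pure a (E s)"])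
      (auto simp: T.abelian_group_axioms E_closed E_add pure_closed pure_add_left pure_add_right
        linear pure_balanced)
  have "d (U \<otimes>\<^bsub>T\<^esub> V) = d U \<otimes>\<^bsub>T\<^esub> V \<oplus>\<^bsub>T\<^esub> U \<otimes>\<^bsub>T\<^esub> d V"
    if U: "U \<in> carrier T" and V: "V \<in> carrier T" for U V
    using U
  proof (induction U rule: tensor_induct)
    case (pure a s)
    from V show ?case
    proof (induction V rule: tensor_induct)
      case (pure b t)
      then show ?case
        using \<open>a \<in> _\<close> \<open>s \<in> _\<close>
        by (simp add: pure_mult d_pure E_closed E_mult pure_add_right)
    next
      case (add V W)
      then show ?case
        using pure_closed[of a s] \<open>a \<in> _\<close> \<open>s \<in> _\<close>
        by (simp add: T.r_distr d_add d_closed T.a_ac)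
    qed
  next
    case (add U W)
    then show ?case
      using V by (simp add: T.l_distr d_add d_closed T.a_ac)
  qed
  then have "derivation T d"
    using d_closed d_add by (auto simp: derivation_def)
  then show ?thesis using d_pure by (intro exI[of _ d]) blast
qed

text \<open>The map sends a (x) s to \<pi>(s) a, balanced by linearity of \<pi> and commutativity of
  \<open>R\<close>. Multiplication by b (x) 1 leaves the second factor alone, so it commutes with
  the projection although \<pi> need not be multiplicative.\<close>

lemma tensor_projection:
  assumes closed: "\<And>s. s \<in> carrier S \<Longrightarrow> \<pi> s \<in> carrier R"
    and add: "\<And>s t. s \<in> carrier S \<Longrightarrow> t \<in> carrier S \<Longrightarrow> \<pi> (s \<oplus>\<^bsub>S\<^esub> t) = \<pi> s \<oplus>\<^bsub>R\<^esub> \<pi> t"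
    and linear: "\<And>c s. c \<in> carrier R \<Longrightarrow> s \<in> carrier S \<Longrightarrow> \<pi> (c \<odot>\<^bsub>S\<^esub> s) = c \<otimes>\<^bsub>R\<^esub> \<pi> s"
  shows "\<exists>p. (\<forall>U\<in>carrier T. p U \<in> carrier A) \<and>
    (\<forall>U\<in>carrier T. \<forall>V\<in>carrier T. p (U \<oplus>\<^bsub>T\<^esub> V) = p U \<oplus>\<^bsub>A\<^esub> p V) \<and>
    (\<forall>a\<in>carrier A. \<forall>s\<in>carrier S. p (pure a s) = \<pi> s \<odot>\<^bsub>A\<^esub> a) \<and>
    (\<forall>b\<in>carrier A. \<forall>U\<in>carrier T. p (pure b \<one>\<^bsub>S\<^esub> \<otimes>\<^bsub>T\<^esub> U) = b \<otimes>\<^bsub>A\<^esub> p U \<and>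
      p (U \<otimes>\<^bsub>T\<^esub> pure b \<one>\<^bsub>S\<^esub>) = p U \<otimes>\<^bsub>A\<^esub> b)"
proof -
  interpret RA: module R A by (rule assoc_algebra.axioms(1)[OF A])
  obtain p where p_closed: "\<And>U. U \<in> carrier T \<Longrightarrow> p U \<in> carrier A"
    and p_add: "\<And>U V. U \<in> carrier T \<Longrightarrow> V \<in> carrier T \<Longrightarrow> p (U \<oplus>\<^bsub>T\<^esub> V) = p U \<oplus>\<^bsub>A\<^esub> p V"
    and p_pure: "\<And>a s. a \<in> carrier A \<Longrightarrow> s \<in> carrier S \<Longrightarrow> p (pure a s) = \<pi> s \<odot>\<^bsub>A\<^esub> a"
    by (rule tensor_lift[of A "\<lambda>a s. \<pi> s \<odot>\<^bsub>A\<^esub> a"])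
      (auto simp: A.abelian_group_axioms closed add linear RA.smult_l_distr RA.smult_r_distr
        RA.smult_assoc1[symmetric] RA.m_comm)
  have p_mult: "p (pure b \<one>\<^bsub>S\<^esub> \<otimes>\<^bsub>T\<^esub> U) = b \<otimes>\<^bsub>A\<^esub> p U" "p (U \<otimes>\<^bsub>T\<^esub> pure b \<one>\<^bsub>S\<^esub>) = p U \<otimes>\<^bsub>A\<^esub> b"
    if b: "b \<in> carrier A" and U: "U \<in> carrier T" for b U
  proof -
    have b1: "pure b \<one>\<^bsub>S\<^esub> \<in> carrier T" using b by (intro pure_closed) auto
    show "p (pure b \<one>\<^bsub>S\<^esub> \<otimes>\<^bsub>T\<^esub> U) = b \<otimes>\<^bsub>A\<^esub> p U"
      using U
    proof (induction U rule: tensor_induct)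
      case (pure a s)
      then show ?case using b by (simp add: pure_mult p_pure closed smult)
    next
      case (add U V)
      then show ?case using b b1 by (simp add: T.r_distr A.r_distr p_add p_closed)
    qed
    show "p (U \<otimes>\<^bsub>T\<^esub> pure b \<one>\<^bsub>S\<^esub>) = p U \<otimes>\<^bsub>A\<^esub> b"
      using U
    proof (induction U rule: tensor_induct)
      case (pure a s)
      then show ?case using b by (simp add: pure_mult p_pure closed smult)
    next
      case (add U V)
      then show ?case using b b1 by (simp add: T.l_distr A.l_distr p_add p_closed)
    qed
  qed
  show ?thesis
    by (intro exI[of _ p] conjI ballI p_closed p_add p_pure p_mult)
qed

end

section \<open>Derivations of forms\<close>

lemma extension_algebra_simps [simp]:
  "carrier (extension_algebra i) = UNIV" "x \<otimes>\<^bsub>extension_algebra i\<^esub> y = x * y"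
  "\<one>\<^bsub>extension_algebra i\<^esub> = 1" "\<zero>\<^bsub>extension_algebra i\<^esub> = 0" "x \<oplus>\<^bsub>extension_algebra i\<^esub> y = x + y"
  "c \<odot>\<^bsub>extension_algebra i\<^esub> x = i c * x"
  by (simp_all add: extension_algebra_def)

lemma ring_of_type_algebra_simps [simp]:
  "carrier ring_of_type_algebra = UNIV" "x \<otimes>\<^bsub>ring_of_type_algebra\<^esub> y = x * y"
  "\<one>\<^bsub>ring_of_type_algebra\<^esub> = 1" "\<zero>\<^bsub>ring_of_type_algebra\<^esub> = 0"
  "x \<oplus>\<^bsub>ring_of_type_algebra\<^esub> y = x + y"
  by (simp_all add: ring_of_type_algebra_def)

context field_embedding
begin

text \<open>The carrier of \<open>R\<close> is left open so that the field F and its constants are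
  both covered.\<close>

lemma assoc_algebra_extension:
  assumes "cring R" "\<And>x y. x \<oplus>\<^bsub>R\<^esub> y = x + y" "\<And>x y. x \<otimes>\<^bsub>R\<^esub> y = x * y" "\<one>\<^bsub>R\<^esub> = 1"
  shows "assoc_algebra R (extension_algebra i)"
proof -
  have ab: "abelian_group (extension_algebra i)"
  proof (rule abelian_groupI)
    fix x assume "x \<in> carrier (extension_algebra i)"
    show "\<exists>y\<in>carrier (extension_algebra i). y \<oplus>\<^bsub>extension_algebra i\<^esub> x = \<zero>\<^bsub>extension_algebra i\<^esub>"
      by (intro bexI[of _ "- x"]) simp_all
  qed (simp_all add: ac_simps)
  have "module R (extension_algebra i)"
    by (rule moduleI[OF assms(1) ab]) (simp_all add: assms(2-) one add mult algebra_simps)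
  moreover have "ring (extension_algebra i)"
    by (rule ringI[OF ab]) (auto intro!: monoidI simp: algebra_simps)
  ultimately show ?thesis
    by (auto simp: assoc_algebra_def assoc_algebra_axioms_def mult_ac)
qed

text \<open>The independent set {1} extends to a basis of the large field over the small one, so a
  linear functional may be prescribed at 1.\<close>

lemma linear_retraction:
  "\<exists>\<pi>. (\<forall>x y. \<pi> (x + y) = \<pi> x + \<pi> y) \<and> (\<forall>c x. \<pi> (i c * x) = c * \<pi> x) \<and> \<pi> 1 = 1"
proof -
  interpret vector_space_pair "\<lambda>c x. i c * x" "(*)"
    by unfold_locales (simp_all add: one add mult algebra_simps)
  have 1: "vs1.independent {1}" by simp
  interpret \<pi>: Vector_Spaces.linear "\<lambda>c x. i c * x" "(*)" "construct {1} (\<lambda>_. 1)"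
    by (rule linear_construct[OF 1])
  show ?thesis
    by (intro exI[of _ "construct {1} (\<lambda>_. 1)"])
      (simp only: \<pi>.add \<pi>.scale construct_basis[OF 1] singletonI simp_thms)
qed

end

theorem corollary2p3p1:
  fixes D :: "'f::field \<Rightarrow> 'f"
    and i :: "'f \<Rightarrow> 'l::field"
    and A :: "('f, 'a) module"
    and B :: "('f, 'b) module"
  assumes "derivation ring_of_type_algebra D"
    and "assoc_algebra (constants ring_of_type_algebra D) A"
    and "finitely_spanned (constants ring_of_type_algebra D) A"
    and "smooth_aut_scheme (constants ring_of_type_algebra D) A"
    and "separable_closure i"
    and "is_form (constants ring_of_type_algebra D) A ring_of_type_algebra B (extension_algebra i)"
  shows "\<exists>\<delta>. derivation B \<delta> \<and> (\<forall>x. \<delta> (x \<odot>\<^bsub>B\<^esub> \<one>\<^bsub>B\<^esub>) = D x \<odot>\<^bsub>B\<^esub> \<one>\<^bsub>B\<^esub>)"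
proof -
  let ?C = "constants ring_of_type_algebra D" and ?F = "ring_of_type_algebra :: 'f ring"
    and ?L = "extension_algebra i"
  interpret separable_closure i by fact
  interpret field_embedding i
    using ring_hom_add[OF embedding] ring_hom_mult[OF embedding] ring_hom_one[OF embedding]
    by unfold_locales simp_all
  have D: "D (x + y) = D x + D y" "D (x * y) = D x * y + x * D y" for x y
    using assms(1) by (simp_all add: derivation_def)
  obtain E where E: "\<And>x y. E (x + y) = E x + E y" "\<And>x y. E (x * y) = E x * y + x * E y"
    "\<And>x. E (i x) = i (D x)"
    using derivation_extends[of D] D separable by blast
  have E_derivation: "derivation ?L E"
    unfolding derivation_def extension_algebra_simps using E(1,2) by blast
  have E_linear: "E (c \<odot>\<^bsub>?L\<^esub> s) = c \<odot>\<^bsub>?L\<^esub> E s"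
    if "c \<in> carrier ?C" "s \<in> carrier ?L" for c s
  proof -
    have "D c = 0" using that(1) by (simp add: constants_def)
    then show ?thesis unfolding extension_algebra_simps E(2,3) by (simp only: zero mult_zero_left add_0_left)
  qed
  have "cring ?C" "cring ?F"
    using module.axioms(1)[OF assoc_algebra.axioms(1)[OF assms(2)]] cring_from_type_algebra by auto
  then have L: "assoc_algebra ?C ?L" "assoc_algebra ?F ?L"
    by (auto intro!: assoc_algebra_extension simp: constants_def)
  obtain h where B: "assoc_algebra ?F B" and h: "h \<in> alg_iso ?L (tensor ?C A ?L) (tensor ?F B ?L)"
    using assms(6) by (auto simp: is_form_def)
  interpret A: tensor_product ?C A ?L by (rule tensor_product.intro[OF assms(2) L(1)])
  interpret B: tensor_product ?F B ?L by (rule tensor_product.intro[OF B L(2)])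
  have h_iso: "h \<in> ring_iso A.T B.T"
    using h by (simp add: alg_iso_def alg_hom_def ring_iso_def)
  then have h_hom: "h \<in> ring_hom A.T B.T" by (simp add: ring_iso_def)
  define g where "g = inv_into (carrier A.T) h"
  have g_hom: "g \<in> ring_hom B.T A.T"
    using ring_iso_set_sym[OF A.T.ring_axioms h_iso] by (simp add: g_def ring_iso_def)
  have hg: "h (g U) = U" if "U \<in> carrier B.T" for U
    unfolding g_def using that h_iso by (intro f_inv_into_f) (simp add: ring_iso_def bij_betw_def)
  have gh: "g (h U) = U" if "U \<in> carrier A.T" for U
    unfolding g_def using that h_iso by (intro inv_into_f_f) (simp_all add: ring_iso_def bij_betw_def)
  \<comment> \<open>1 (x) s is the scalar s applied to the unit, and \<open>h\<close> is unital and
    linear over the extension field. Hence the transported derivation still acts as \<open>E\<close>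
    on scalars.\<close>
  have h_scalar: "h (A.pure \<one>\<^bsub>A\<^esub> s) = B.pure \<one>\<^bsub>B\<^esub> s" for s
  proof -
    have "h (s \<odot>\<^bsub>A.T\<^esub> \<one>\<^bsub>A.T\<^esub>) = s \<odot>\<^bsub>B.T\<^esub> h \<one>\<^bsub>A.T\<^esub>"
      using h by (simp add: alg_iso_def alg_hom_def)
    then show ?thesis
      using ring_hom_one[OF h_hom] A.pure_closed[of "\<one>\<^bsub>A\<^esub>" s] B.pure_closed[of "\<one>\<^bsub>B\<^esub>" s]
      by (simp add: A.smult_T B.smult_T)
  qed
  have "\<exists>d. derivation A.T d \<and> (\<forall>a\<in>carrier A. \<forall>s\<in>carrier ?L. d (A.pure a s) = A.pure a (E s))"
    by (rule A.derivation_tensor[OF E_derivation]) (rule E_linear)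
  then obtain d where d: "derivation A.T d"
    and "\<forall>a\<in>carrier A. \<forall>s\<in>carrier ?L. d (A.pure a s) = A.pure a (E s)"
    by (elim exE conjE) (rule that)
  then have d_pure: "d (A.pure a s) = A.pure a (E s)" if "a \<in> carrier A" for a s
    using that by simp
  obtain \<pi> where \<pi>: "\<And>x y. \<pi> (x + y) = \<pi> x + \<pi> y" "\<And>c x. \<pi> (i c * x) = c * \<pi> x" "\<pi> 1 = 1"
    using linear_retraction by blast
  have "\<pi> s \<in> carrier ?F" "\<pi> (s \<oplus>\<^bsub>?L\<^esub> t) = \<pi> s \<oplus>\<^bsub>?F\<^esub> \<pi> t" "\<pi> (c \<odot>\<^bsub>?L\<^esub> s) = c \<otimes>\<^bsub>?F\<^esub> \<pi> s" for c s t
    by (simp_all add: \<pi>)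
  from B.tensor_projection[of \<pi>, OF this]
  obtain p where p_closed: "\<forall>U\<in>carrier B.T. p U \<in> carrier B"
    and p_add: "\<forall>U\<in>carrier B.T. \<forall>V\<in>carrier B.T. p (U \<oplus>\<^bsub>B.T\<^esub> V) = p U \<oplus>\<^bsub>B\<^esub> p V"
    and "\<forall>b\<in>carrier B. \<forall>s\<in>carrier ?L. p (B.pure b s) = \<pi> s \<odot>\<^bsub>B\<^esub> b"
    and "\<forall>b\<in>carrier B. \<forall>U\<in>carrier B.T. p (B.pure b \<one>\<^bsub>?L\<^esub> \<otimes>\<^bsub>B.T\<^esub> U) = b \<otimes>\<^bsub>B\<^esub> p U \<and>
      p (U \<otimes>\<^bsub>B.T\<^esub> B.pure b \<one>\<^bsub>?L\<^esub>) = p U \<otimes>\<^bsub>B\<^esub> b"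
    by (elim exE conjE) (rule that)
  then have p_pure: "p (B.pure b s) = \<pi> s \<odot>\<^bsub>B\<^esub> b"
    and p_mult: "U \<in> carrier B.T \<Longrightarrow> p (B.pure b 1 \<otimes>\<^bsub>B.T\<^esub> U) = b \<otimes>\<^bsub>B\<^esub> p U"
      "U \<in> carrier B.T \<Longrightarrow> p (U \<otimes>\<^bsub>B.T\<^esub> B.pure b 1) = p U \<otimes>\<^bsub>B\<^esub> b"
    if "b \<in> carrier B" for b s U
    using that by simp_all
  define \<epsilon> where "\<epsilon> U = h (d (g U))" for U
  have d_closed: "d U \<in> carrier A.T" if "U \<in> carrier A.T" for U
    using d that by (auto simp: derivation_def)
  have \<epsilon>_closed: "\<epsilon> U \<in> carrier B.T" if "U \<in> carrier B.T" for U
    unfolding \<epsilon>_def by (intro ring_hom_closed[OF h_hom] d_closed ring_hom_closed[OF g_hom] that)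
  have \<epsilon>: "\<epsilon> (U \<oplus>\<^bsub>B.T\<^esub> V) = \<epsilon> U \<oplus>\<^bsub>B.T\<^esub> \<epsilon> V"
    "\<epsilon> (U \<otimes>\<^bsub>B.T\<^esub> V) = \<epsilon> U \<otimes>\<^bsub>B.T\<^esub> V \<oplus>\<^bsub>B.T\<^esub> U \<otimes>\<^bsub>B.T\<^esub> \<epsilon> V"
    if "U \<in> carrier B.T" "V \<in> carrier B.T" for U V
    using that d d_closed ring_hom_closed[OF g_hom] ring_hom_closed[OF h_hom]
    by (simp_all add: \<epsilon>_def derivation_def hg ring_hom_add[OF g_hom] ring_hom_mult[OF g_hom]
        ring_hom_add[OF h_hom] ring_hom_mult[OF h_hom])
  define \<delta> where "\<delta> b = p (\<epsilon> (B.pure b 1))" for b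
  have b1: "B.pure b 1 \<in> carrier B.T" if "b \<in> carrier B" for b
    using B.pure_closed that by simp
  have "derivation B \<delta>"
    unfolding derivation_def
  proof (intro conjI ballI)
    show "\<delta> \<in> carrier B \<rightarrow> carrier B"
      using p_closed \<epsilon>_closed b1 by (auto simp: \<delta>_def)
    fix a b assume ab: "a \<in> carrier B" "b \<in> carrier B"
    show "\<delta> (a \<oplus>\<^bsub>B\<^esub> b) = \<delta> a \<oplus>\<^bsub>B\<^esub> \<delta> b"
      using ab b1 \<epsilon>_closed \<epsilon> p_add by (simp add: \<delta>_def B.pure_add_left)
    \<comment> \<open>After the product rule for \<epsilon>, \<open>p_mult\<close> extracts b on the
      right of the first summand and a on the left of the second.\<close>
    have "B.pure (a \<otimes>\<^bsub>B\<^esub> b) 1 = B.pure a 1 \<otimes>\<^bsub>B.T\<^esub> B.pure b 1"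
      using B.pure_mult[of a 1 b 1] ab by simp
    then show "\<delta> (a \<otimes>\<^bsub>B\<^esub> b) = \<delta> a \<otimes>\<^bsub>B\<^esub> b \<oplus>\<^bsub>B\<^esub> a \<otimes>\<^bsub>B\<^esub> \<delta> b"
      using ab b1 \<epsilon>_closed \<epsilon> p_add p_mult by (simp add: \<delta>_def)
  qed
  moreover have "\<delta> (x \<odot>\<^bsub>B\<^esub> \<one>\<^bsub>B\<^esub>) = D x \<odot>\<^bsub>B\<^esub> \<one>\<^bsub>B\<^esub>" for x
  proof -
    \<comment> \<open>Moving x into the second factor makes it a scalar, on which the action of
      \<open>g\<close>, \<open>d\<close> and \<open>h\<close> is known; elsewhere in B (x) L the
      isomorphism is arbitrary.\<close>
    have "B.pure (x \<odot>\<^bsub>B\<^esub> \<one>\<^bsub>B\<^esub>) 1 = B.pure \<one>\<^bsub>B\<^esub> (i x)"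
      using B.pure_balanced[of x "\<one>\<^bsub>B\<^esub>" 1] by simp
    moreover have "g (B.pure \<one>\<^bsub>B\<^esub> (i x)) = A.pure \<one>\<^bsub>A\<^esub> (i x)"
      using gh[of "A.pure \<one>\<^bsub>A\<^esub> (i x)"] A.pure_closed by (simp add: h_scalar)
    ultimately have "\<epsilon> (B.pure (x \<odot>\<^bsub>B\<^esub> \<one>\<^bsub>B\<^esub>) 1) = B.pure \<one>\<^bsub>B\<^esub> (i (D x))"
      by (simp add: \<epsilon>_def d_pure E h_scalar)
    then show ?thesis
      using p_pure[of "\<one>\<^bsub>B\<^esub>" "i (D x)"] \<pi>(2)[of "D x" 1] \<pi>(3) by (simp add: \<delta>_def)
  qed
  ultimately show ?thesis by blast
qed

end
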